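(* Let $v_1,v_2\in\mathbb{R}^2$ be linearly independent unit vectors and $\lambda_1,\lambda_2>0$. Every $(v_1,v_2)$-maximum circle is a parallelogram with the same center, each of whose sides is perpendicular to $v_1$ or $v_2$. In addition, if $\lambda_1=\lambda_2$ then it is a rhombus; if $v_1\perp v_2$ then it is a rectangle; and if $\lambda_1=\lambda_2$ and $v_1\perp v_2$ then it is a square.
   Context: Write $v_i=(v_{i1},v_{i2})$. The $(v_1,v_2)$-maximum distance (with weights $\lambda_1,\lambda_2$) between $P_1=(x_1,y_1)$ and $P_2=(x_2,y_2)$ in $\mathbb{R}^2$ is $$d_{M(v_1,v_2)}(P_1,P_2)=\max\{\lambda_1|v_{11}(x_1-x_2)+v_{12}(y_1-y_2)|,\ \lambda_2|v_{21}(x_1-x_2)+v_{22}(y_1-y_2)|\}.$$ A $(v_1,v_2)$-maximum circle with center $C\in\mathbb{R}^2$ and radius $r>0$ is the set $\{P\in\mathbb{R}^2: d_{M(v_1,v_2)}(C,P)=r\}$. Parallelogram, rectangle, rhombus, square (meaning their boundary curves, nondegenerate) and perpendicularity are in the Euclidean sense; the center of such a figure is its center of symmetry. *)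

theory Defs
  imports "HOL-Analysis.Analysis"
begin

definition max_dist :: "real \<Rightarrow> real \<Rightarrow> real^2 \<Rightarrow> real^2 \<Rightarrow> real^2 \<Rightarrow> real^2 \<Rightarrow> real" where
  "max_dist l1 l2 v1 v2 P Q =
     max (l1 * \<bar>v1$1 * (P$1 - Q$1) + v1$2 * (P$2 - Q$2)\<bar>)
         (l2 * \<bar>v2$1 * (P$1 - Q$1) + v2$2 * (P$2 - Q$2)\<bar>)"

definition max_circle :: "real \<Rightarrow> real \<Rightarrow> real^2 \<Rightarrow> real^2 \<Rightarrow> real^2 \<Rightarrow> real \<Rightarrow> (real^2) set" where
  "max_circle l1 l2 v1 v2 ctr r = {P. max_dist l1 l2 v1 v2 ctr P = r}"

text \<open>Quadrilaterals are given by their vertices in cyclic order; the figure itself is the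
  boundary curve, not the enclosed region.\<close>

definition sides :: "real^2 \<Rightarrow> real^2 \<Rightarrow> real^2 \<Rightarrow> real^2 \<Rightarrow> ((real^2) \<times> (real^2)) set" where
  "sides A B C D = {(A, B), (B, C), (C, D), (D, A)}"

definition boundary_curve :: "real^2 \<Rightarrow> real^2 \<Rightarrow> real^2 \<Rightarrow> real^2 \<Rightarrow> (real^2) set" where
  "boundary_curve A B C D = (\<Union>(P, Q)\<in>sides A B C D. closed_segment P Q)"

text \<open>The vector equation says that the opposite sides \<open>AB\<close> and \<open>DC\<close> are parallel and of equal
  length (equivalently \<open>BC\<close> and \<open>AD\<close>); non-collinearity excludes degenerate figures.\<close>

definition parallelogram :: "real^2 \<Rightarrow> real^2 \<Rightarrow> real^2 \<Rightarrow> real^2 \<Rightarrow> bool" where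
  "parallelogram A B C D \<longleftrightarrow> \<not> collinear {A, B, C} \<and> B - A = C - D"

definition rhombus :: "real^2 \<Rightarrow> real^2 \<Rightarrow> real^2 \<Rightarrow> real^2 \<Rightarrow> bool" where
  "rhombus A B C D \<longleftrightarrow> parallelogram A B C D \<and>
     dist A B = dist B C \<and> dist B C = dist C D \<and> dist C D = dist D A"

definition rectangle :: "real^2 \<Rightarrow> real^2 \<Rightarrow> real^2 \<Rightarrow> real^2 \<Rightarrow> bool" where
  "rectangle A B C D \<longleftrightarrow> parallelogram A B C D \<and>
     orthogonal (B - A) (D - A) \<and> orthogonal (C - B) (A - B) \<and>
     orthogonal (D - C) (B - C) \<and> orthogonal (A - D) (C - D)"

definition square :: "real^2 \<Rightarrow> real^2 \<Rightarrow> real^2 \<Rightarrow> real^2 \<Rightarrow> bool" where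
  "square A B C D \<longleftrightarrow> rhombus A B C D \<and> rectangle A B C D"

text \<open>Invariance under the point reflection in \<open>c\<close>; for a nonempty bounded set there is at most
  one such \<open>c\<close>.\<close>

definition center_of_symmetry :: "real^2 \<Rightarrow> (real^2) set \<Rightarrow> bool" where
  "center_of_symmetry c S \<longleftrightarrow> (\<lambda>P. 2 *\<^sub>R c - P) ` S = S"

end

theory Submission
  imports Defs
begin

text \<open>Let \<open>e\<^sub>1, e\<^sub>2\<close> be the basis dual to \<open>v\<^sub>1, v\<^sub>2\<close> and put \<open>a = (r / \<lambda>\<^sub>1) e\<^sub>1\<close>,
  \<open>b = (r / \<lambda>\<^sub>2) e\<^sub>2\<close>. The point \<open>c + s a + t b\<close> has distance \<open>r max(|s|, |t|)\<close> from \<open>c\<close>,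
  so the circle consists of the points with \<open>max(|s|, |t|) = 1\<close>, that is, of the parallelogram
  with vertices \<open>c \<plusminus> a \<plusminus> b\<close>. Its sides are parallel to \<open>a \<bottom> v\<^sub>2\<close> and \<open>b \<bottom> v\<^sub>1\<close>.
  Since the dual basis of two plane unit vectors arises from them by a quarter turn and a
  scaling, \<open>a\<close> and \<open>b\<close> have equal length if \<open>\<lambda>\<^sub>1 = \<lambda>\<^sub>2\<close> and are orthogonal if
  \<open>v\<^sub>1 \<bottom> v\<^sub>2\<close>.\<close>

text \<open>The substitution \<open>s = 1 - 2 * u\<close> turns the parameter range [0, 1] into
  [-1, 1]. Measured from its midpoint, a side of the parallelogram becomes a bound on one
  coordinate.\<close>

lemma closed_segment_symmetric:
  fixes m a :: "'a::real_vector"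
  shows "closed_segment (m + a) (m - a) = {m + s *\<^sub>R a | s. \<bar>s\<bar> \<le> 1}"
proof (intro subset_antisym subsetI)
  fix x assume "x \<in> closed_segment (m + a) (m - a)"
  then obtain u where "0 \<le> u" "u \<le> 1" "x = (1 - u) *\<^sub>R (m + a) + u *\<^sub>R (m - a)"
    by (auto simp: closed_segment_def)
  then have "x = m + (1 - 2 * u) *\<^sub>R a" "\<bar>1 - 2 * u\<bar> \<le> 1"
    by (auto simp: algebra_simps simp flip: scaleR_2)
  then show "x \<in> {m + s *\<^sub>R a | s. \<bar>s\<bar> \<le> 1}" by blast
next
  fix x assume "x \<in> {m + s *\<^sub>R a | s. \<bar>s\<bar> \<le> 1}"
  then obtain s :: real where s: "\<bar>s\<bar> \<le> 1" "x = m + s *\<^sub>R a" by blast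
  define u where "u = (1 - s) / 2"
  have "s = 1 - 2 * u" by (simp add: u_def field_simps)
  with s have "x = m + (1 - 2 * u) *\<^sub>R a" by simp
  then have "x = (1 - u) *\<^sub>R (m + a) + u *\<^sub>R (m - a)"
    by (simp add: algebra_simps flip: scaleR_2)
  moreover have "0 \<le> u" "u \<le> 1" using s by (auto simp: u_def)
  ultimately show "x \<in> closed_segment (m + a) (m - a)"
    by (auto simp: closed_segment_def)
qed

lemma boundary_curve_centered:
  "boundary_curve (c + a + b) (c - a + b) (c - a - b) (c + a - b) =
     {c + s *\<^sub>R a + t *\<^sub>R b | s t. max \<bar>s\<bar> \<bar>t\<bar> = 1}"
proof -
  have AB: "closed_segment (c + a + b) (c - a + b) = {c + s *\<^sub>R a + b | s. \<bar>s\<bar> \<le> 1}"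
    using closed_segment_symmetric[of "c + b" a] by (simp add: algebra_simps)
  have BC: "closed_segment (c - a + b) (c - a - b) = {c - a + t *\<^sub>R b | t. \<bar>t\<bar> \<le> 1}"
    by (rule closed_segment_symmetric)
  have CD: "closed_segment (c - a - b) (c + a - b) = {c + s *\<^sub>R a - b | s. \<bar>s\<bar> \<le> 1}"
    using closed_segment_symmetric[of "c - b" a]
    by (subst closed_segment_commute) (simp add: algebra_simps)
  have DA: "closed_segment (c + a - b) (c + a + b) = {c + a + t *\<^sub>R b | t. \<bar>t\<bar> \<le> 1}"
    by (subst closed_segment_commute) (rule closed_segment_symmetric)
  \<comment> \<open>The unit circle of the maximum norm splits into four edges, listed in the order
    of the sides \<open>AB\<close>, \<open>BC\<close>, \<open>CD\<close>, \<open>DA\<close>.\<close>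
  have *: "max \<bar>s\<bar> \<bar>t\<bar> = 1 \<longleftrightarrow>
      \<bar>s\<bar> \<le> 1 \<and> t = 1 \<or> s = -1 \<and> \<bar>t\<bar> \<le> 1 \<or> \<bar>s\<bar> \<le> 1 \<and> t = -1 \<or> s = 1 \<and> \<bar>t\<bar> \<le> 1"
    for s t :: real by (auto simp: max_def abs_if split: if_splits)
  have "{c + s *\<^sub>R a + t *\<^sub>R b | s t. max \<bar>s\<bar> \<bar>t\<bar> = 1} =
      {c + s *\<^sub>R a + b | s. \<bar>s\<bar> \<le> 1} \<union> {c - a + t *\<^sub>R b | t. \<bar>t\<bar> \<le> 1} \<union>
      {c + s *\<^sub>R a - b | s. \<bar>s\<bar> \<le> 1} \<union> {c + a + t *\<^sub>R b | t. \<bar>t\<bar> \<le> 1}"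
  proof (intro set_eqI)
    fix x
    \<comment> \<open>The coefficients 1 and -1 stay explicit, so that this step is pure logic: on
      each edge one of \<open>s\<close>, \<open>t\<close> is replaced by its fixed value.\<close>
    have "x \<in> {c + s *\<^sub>R a + t *\<^sub>R b | s t. max \<bar>s\<bar> \<bar>t\<bar> = 1} \<longleftrightarrow>
      (\<exists>s. \<bar>s\<bar> \<le> 1 \<and> x = c + s *\<^sub>R a + 1 *\<^sub>R b) \<or> (\<exists>t. \<bar>t\<bar> \<le> 1 \<and> x = c + (-1) *\<^sub>R a + t *\<^sub>R b) \<or>
      (\<exists>s. \<bar>s\<bar> \<le> 1 \<and> x = c + s *\<^sub>R a + (-1) *\<^sub>R b) \<or> (\<exists>t. \<bar>t\<bar> \<le> 1 \<and> x = c + 1 *\<^sub>R a + t *\<^sub>R b)"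
      unfolding * mem_Collect_eq by blast
    then show "x \<in> {c + s *\<^sub>R a + t *\<^sub>R b | s t. max \<bar>s\<bar> \<bar>t\<bar> = 1} \<longleftrightarrow>
      x \<in> {c + s *\<^sub>R a + b | s. \<bar>s\<bar> \<le> 1} \<union> {c - a + t *\<^sub>R b | t. \<bar>t\<bar> \<le> 1} \<union>
      {c + s *\<^sub>R a - b | s. \<bar>s\<bar> \<le> 1} \<union> {c + a + t *\<^sub>R b | t. \<bar>t\<bar> \<le> 1}"
      by auto
  qed
  then show ?thesis
    by (simp add: boundary_curve_def sides_def AB BC CD DA Un_assoc)
qed

text \<open>The reflection negates both coordinates \<open>s\<close> and \<open>t\<close>, which
  leaves \<open>max \<bar>s\<bar> \<bar>t\<bar>\<close> unchanged.\<close>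

lemma center_of_symmetry_boundary_curve_centered:
  "center_of_symmetry c (boundary_curve (c + a + b) (c - a + b) (c - a - b) (c + a - b))"
proof -
  define S where "S = boundary_curve (c + a + b) (c - a + b) (c - a - b) (c + a - b)"
  have refl: "2 *\<^sub>R c - P \<in> S" if "P \<in> S" for P
  proof -
    from that obtain s t where st: "max \<bar>s\<bar> \<bar>t\<bar> = 1" "P = c + s *\<^sub>R a + t *\<^sub>R b"
      unfolding S_def boundary_curve_centered by blast
    have "2 *\<^sub>R c - P = c + (- s) *\<^sub>R a + (- t) *\<^sub>R b" "max \<bar>- s\<bar> \<bar>- t\<bar> = 1"
      using st by (simp_all add: scaleR_2)
    then show ?thesis unfolding S_def boundary_curve_centered by blast
  qed
  \<comment> \<open>The reflection is an involution, so \<open>P\<close> is the image of its own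
    reflection.\<close>
  have "P \<in> (\<lambda>P. 2 *\<^sub>R c - P) ` S" if "P \<in> S" for P
    using refl[OF that] by (rule rev_image_eqI) simp
  with refl show ?thesis
    unfolding center_of_symmetry_def S_def[symmetric] by blast
qed

text \<open>If the determinant vanishes, \<open>v\<close> equals its projection
  \<open>(v \<bullet> w) *\<^sub>R w\<close> onto the unit vector \<open>w\<close>. The assumption
  \<open>v \<noteq> w\<close> keeps the set \<open>{v, w}\<close> from collapsing to a
  singleton.\<close>

lemma det_nonzero_if_independent:
  fixes v w :: "real^2"
  assumes "norm w = 1" "v \<noteq> w" "independent {v, w}"
  shows "v$1 * w$2 - v$2 * w$1 \<noteq> 0"
proof
  assume det: "v$1 * w$2 - v$2 * w$1 = 0"
  have w: "w$1 * w$1 + w$2 * w$2 = 1"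
    using assms(1) by (simp add: norm_eq_1 inner_vec_def sum_2)
  have "v$1 = (v$1 * w$1 + v$2 * w$2) * w$1" "v$2 = (v$1 * w$1 + v$2 * w$2) * w$2"
    using w det by algebra+
  then have "v = (v$1 * w$1 + v$2 * w$2) *\<^sub>R w"
    by (simp add: vec_eq_iff forall_2)
  then have "v \<in> span {w}" by (metis span_base span_scale singletonI)
  with assms(2,3) show False by (simp add: independent_insert)
qed

lemma dual_basis_2:
  fixes v w :: "real^2"
  assumes det: "v$1 * w$2 - v$2 * w$1 \<noteq> 0"
  obtains e f where "v \<bullet> e = 1" "w \<bullet> e = 0" "v \<bullet> f = 0" "w \<bullet> f = 1"
    "\<And>x. x = (v \<bullet> x) *\<^sub>R e + (w \<bullet> x) *\<^sub>R f"
    "norm v = norm w \<Longrightarrow> norm e = norm f"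
    "orthogonal v w \<Longrightarrow> orthogonal e f"
proof -
  define d where "d = v$1 * w$2 - v$2 * w$1"
  have d: "d \<noteq> 0" using det by (simp add: d_def)
  \<comment> \<open>Cramer's rule: \<open>e\<close> and \<open>f\<close> are \<open>w\<close> and
    \<open>v\<close>, turned by a right angle in opposite directions and divided by
    \<open>d\<close>. Hence \<open>e \<bullet> f\<close> is \<open>- (v \<bullet> w)\<close> divided
    by the square of \<open>d\<close>.\<close>
  define e :: "real^2" where "e = vector [w$2 / d, - w$1 / d]"
  define f :: "real^2" where "f = vector [- v$2 / d, v$1 / d]"
  note simps = inner_vec_def sum_2 e_def f_def
  show thesis
  proof (rule that)
    show "v \<bullet> e = 1" "w \<bullet> e = 0" "v \<bullet> f = 0" "w \<bullet> f = 1"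
      using d by (simp_all add: simps field_simps) (simp_all add: d_def algebra_simps)
  next
    show "x = (v \<bullet> x) *\<^sub>R e + (w \<bullet> x) *\<^sub>R f" for x
      using d by (simp add: simps vec_eq_iff forall_2 field_simps)
        (simp add: d_def algebra_simps)
  next
    assume "norm v = norm w"
    then show "norm e = norm f"
      by (simp add: norm_eq simps flip: add_divide_distrib)
  next
    assume "orthogonal v w"
    then show "orthogonal e f"
      using d by (simp add: orthogonal_def simps field_simps)
  qed
qed

lemma max_dist_inner:
  "max_dist l1 l2 v1 v2 P Q = max (l1 * \<bar>v1 \<bullet> (Q - P)\<bar>) (l2 * \<bar>v2 \<bullet> (Q - P)\<bar>)"
proof -
  have "v$1 * (P$1 - Q$1) + v$2 * (P$2 - Q$2) = - (v \<bullet> (Q - P))" for v :: "real^2"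
    by (simp add: inner_vec_def sum_2 algebra_simps)
  then show ?thesis by (simp add: max_dist_def)
qed

theorem theorem4p1:
  fixes v1 v2 ctr :: "real^2" and l1 l2 r :: real
  assumes "norm v1 = 1" and "norm v2 = 1"
    and "v1 \<noteq> v2" and "independent {v1, v2}"
    and "l1 > 0" and "l2 > 0" and "r > 0"
  shows "\<exists>A B C D.
      max_circle l1 l2 v1 v2 ctr r = boundary_curve A B C D \<and>
      parallelogram A B C D \<and>
      center_of_symmetry ctr (boundary_curve A B C D) \<and>
      (\<forall>(P, Q)\<in>sides A B C D. orthogonal (Q - P) v1 \<or> orthogonal (Q - P) v2) \<and>
      (l1 = l2 \<longrightarrow> rhombus A B C D) \<and>
      (orthogonal v1 v2 \<longrightarrow> rectangle A B C D) \<and>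
      (l1 = l2 \<and> orthogonal v1 v2 \<longrightarrow> square A B C D)"
proof -
  obtain e f where ef: "v1 \<bullet> e = 1" "v2 \<bullet> e = 0" "v1 \<bullet> f = 0" "v2 \<bullet> f = 1"
    and expand: "\<And>x. x = (v1 \<bullet> x) *\<^sub>R e + (v2 \<bullet> x) *\<^sub>R f"
    and norm_ef: "norm v1 = norm v2 \<Longrightarrow> norm e = norm f"
    and orth_ef: "orthogonal v1 v2 \<Longrightarrow> orthogonal e f"
    using dual_basis_2[OF det_nonzero_if_independent[OF assms(2-4)]] by metis
  define a where "a = (r / l1) *\<^sub>R e"
  define b where "b = (r / l2) *\<^sub>R f"
  have va: "v1 \<bullet> a = r / l1" "v2 \<bullet> a = 0" and vb: "v1 \<bullet> b = 0" "v2 \<bullet> b = r / l2"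
    using ef by (simp_all add: a_def b_def)
  let ?A = "ctr + a + b" and ?B = "ctr - a + b" and ?C = "ctr - a - b" and ?D = "ctr + a - b"
  have edges: "?B - ?A = - (2 *\<^sub>R a)" "?C - ?B = - (2 *\<^sub>R b)" "?D - ?C = 2 *\<^sub>R a" "?A - ?D = 2 *\<^sub>R b"
    by (simp_all add: scaleR_2)
  \<comment> \<open>Duality removes the mixed terms, and the factors \<open>r / l1\<close> and
    \<open>r / l2\<close> in \<open>a\<close> and \<open>b\<close> cancel the weights.\<close>
  have dist_ab: "max_dist l1 l2 v1 v2 ctr (ctr + s *\<^sub>R a + t *\<^sub>R b) = r * max \<bar>s\<bar> \<bar>t\<bar>" for s t
    using assms(5-7) va vb
    by (simp add: max_dist_inner inner_right_distrib inner_diff_right abs_mult max_mult_distrib_left mult.commute)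
  have coords: "\<exists>s t. P = ctr + s *\<^sub>R a + t *\<^sub>R b" for P
  proof -
    have "P - ctr = (l1 / r * (v1 \<bullet> (P - ctr))) *\<^sub>R a + (l2 / r * (v2 \<bullet> (P - ctr))) *\<^sub>R b"
      using assms(5-7) expand[of "P - ctr"] by (simp add: a_def b_def)
    then show ?thesis by (metis add.assoc add.commute diff_add_cancel)
  qed
  have "max_circle l1 l2 v1 v2 ctr r = {ctr + s *\<^sub>R a + t *\<^sub>R b | s t. max \<bar>s\<bar> \<bar>t\<bar> = 1}"
  proof (intro set_eqI)
    fix P
    have "P \<in> max_circle l1 l2 v1 v2 ctr r \<longleftrightarrow>
        (\<exists>s t. P = ctr + s *\<^sub>R a + t *\<^sub>R b \<and> max_dist l1 l2 v1 v2 ctr (ctr + s *\<^sub>R a + t *\<^sub>R b) = r)"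
      using coords[of P] unfolding max_circle_def mem_Collect_eq by metis
    then show "P \<in> max_circle l1 l2 v1 v2 ctr r \<longleftrightarrow>
        P \<in> {ctr + s *\<^sub>R a + t *\<^sub>R b | s t. max \<bar>s\<bar> \<bar>t\<bar> = 1}"
      using assms(7) unfolding dist_ab by simp
  qed
  then have circle: "max_circle l1 l2 v1 v2 ctr r = boundary_curve ?A ?B ?C ?D"
    by (simp add: boundary_curve_centered)
  have "\<not> collinear {?A, ?B, ?C}"
  proof
    \<comment> \<open>\<open>collinear_3\<close> moves the middle vertex \<open>?B\<close> to the
      origin, so the first edge is needed with reversed sign.\<close>
    have neg_edge: "?A - ?B = 2 *\<^sub>R a" by (simp add: scaleR_2)
    assume "collinear {?A, ?B, ?C}"
    then have "collinear {0, 2 *\<^sub>R a, - (2 *\<^sub>R b)}"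
      using collinear_3[of ?A ?B ?C] unfolding edges(2) neg_edge by simp
    moreover have "a \<noteq> 0" "b \<noteq> 0" using va vb assms(5-7) by auto
    ultimately obtain k where "- (2 *\<^sub>R b) = k *\<^sub>R 2 *\<^sub>R a"
      by (auto simp: collinear_lemma)
    \<comment> \<open>Pairing with \<open>v2\<close> annihilates \<open>a\<close> but not
      \<open>b\<close>.\<close>
    then have "v2 \<bullet> (- (2 *\<^sub>R b)) = v2 \<bullet> (k *\<^sub>R 2 *\<^sub>R a)" by simp
    then show False using va vb assms(6,7) by simp
  qed
  then have para: "parallelogram ?A ?B ?C ?D"
    by (simp add: parallelogram_def)
  have perp: "\<forall>(P, Q)\<in>sides ?A ?B ?C ?D. orthogonal (Q - P) v1 \<or> orthogonal (Q - P) v2"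
    unfolding sides_def by (simp only: ball_simps case_prod_conv edges orthogonal_def
        inner_minus_left inner_scaleR_left inner_commute[of _ v1] inner_commute[of _ v2]) (simp add: va vb)
  have rhom: "rhombus ?A ?B ?C ?D" if "l1 = l2"
  proof -
    have dist_edge: "dist P Q = norm (Q - P)" for P Q :: "real^2"
      by (simp add: dist_norm norm_minus_commute)
    have "norm a = norm b" using that norm_ef assms(1,2) by (simp add: a_def b_def)
    moreover have "dist ?A ?B = 2 * norm a" "dist ?B ?C = 2 * norm b"
        "dist ?C ?D = 2 * norm a" "dist ?D ?A = 2 * norm b"
      by (simp_all only: dist_edge edges norm_minus_cancel norm_scaleR abs_numeral)
    ultimately show ?thesis using para by (simp add: rhombus_def)
  qed
  have rect: "rectangle ?A ?B ?C ?D" if "orthogonal v1 v2"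
  proof -
    have "a \<bullet> b = 0" using orth_ef[OF that] by (simp add: a_def b_def orthogonal_def)
    \<comment> \<open>Each right angle compares the two edges leaving a vertex, one of which runs
      against the cyclic order.\<close>
    moreover have "?D - ?A = - (2 *\<^sub>R b)" "?A - ?B = 2 *\<^sub>R a" "?B - ?C = 2 *\<^sub>R b" "?C - ?D = - (2 *\<^sub>R a)"
      by (simp_all add: scaleR_2)
    ultimately show ?thesis
      using para unfolding rectangle_def edges by (simp add: orthogonal_def inner_commute)
  qed
  show ?thesis
    using circle para center_of_symmetry_boundary_curve_centered perp rhom rect
    unfolding square_def by blast
qed

end
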